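(* Let $\boldsymbol{D}$ be a quantum state divergence that is additive under tensor products of quantum states, i.e. $\boldsymbol{D}(\rho_1\otimes\rho_2\|\sigma_1\otimes\sigma_2)=\boldsymbol{D}(\rho_1\|\sigma_1)+\boldsymbol{D}(\rho_2\|\sigma_2)$ for all states $\rho_1,\sigma_1,\rho_2,\sigma_2$. Let $\mathcal N_1,\mathcal M_1\in\mathrm{CPTP}(A_1\to B_1)$ and $\mathcal N_2,\mathcal M_2\in\mathrm{CPTP}(A_2\to B_2)$. Then $$\boldsymbol{D}^A(\mathcal N_1\otimes\mathcal N_2\|\mathcal M_1\otimes\mathcal M_2)=\boldsymbol{D}^A(\mathcal N_1\|\mathcal M_1)+\boldsymbol{D}^A(\mathcal N_2\|\mathcal M_2).$$
   Context: All Hilbert spaces are finite-dimensional; $\mathfrak{D}(A)$ is the set of density operators on $A$ and $\mathrm{CPTP}(A\to B)$ is the set of quantum channels from $A$ to $B$. A quantum state divergence is a function $\boldsymbol{D}$ assigning to each pair of states $\rho,\sigma\in\mathfrak{D}(A)$ (for any $A$) a value in $\mathbb R\cup\{\infty\}$ such that $\boldsymbol{D}(\mathcal E(\rho)\|\mathcal E(\sigma))\le\boldsymbol{D}(\rho\|\sigma)$ for all $\rho,\sigma\in\mathfrak{D}(A)$ and all channels $\mathcal E\in\mathrm{CPTP}(A\to B)$. The amortized channel divergence of $\mathcal N,\mathcal M\in\mathrm{CPTP}(A\to B)$ is $$\boldsymbol{D}^A(\mathcal N\|\mathcal M)=\sup_{\rho,\sigma\in\mathfrak{D}(RA)}\big[\boldsymbol{D}(\mathcal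 I_R\otimes\mathcal N(\rho_{RA})\|\mathcal I_R\otimes\mathcal M(\sigma_{RA}))-\boldsymbol{D}(\rho_{RA}\|\sigma_{RA})\big],$$ where the supremum is over all states $\rho,\sigma\in\mathfrak{D}(RA)$ with $\boldsymbol{D}(\rho_{RA}\|\sigma_{RA})<\infty$ and over reference systems $R$ of arbitrary finite dimension; $\mathcal I_R$ is the identity channel on $R$. *)

theory Defs
  imports
    "HOL-Library.Extended_Real"
    "Jordan_Normal_Form.Conjugate"
    "Jordan_Normal_Form.Matrix"
begin

text \<open>
  A Hilbert space of dimension \<open>n\<close> is represented by \<open>\<complex>\<^sup>n\<close>, and operators on it by complex
  \<open>n \<times> n\<close> matrices. The tensor product of the spaces of dimension \<open>m\<close> and \<open>n\<close> is the space of
  dimension \<open>m * n\<close>, with the pair of basis indices \<open>(i, k)\<close> encoded as \<open>i * n + k\<close>.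
\<close>

definition kron :: "complex mat \<Rightarrow> complex mat \<Rightarrow> complex mat" where
  "kron A B = mat (dim_row A * dim_row B) (dim_col A * dim_col B)
     (\<lambda>(i, j). A $$ (i div dim_row B, j div dim_col B) * B $$ (i mod dim_row B, j mod dim_col B))"

definition mtrace :: "complex mat \<Rightarrow> complex" where
  "mtrace A = (\<Sum>i<dim_row A. A $$ (i, i))"

text \<open>
  The order on \<^typ>\<open>complex\<close> is the one of \<^theory>\<open>HOL-Library.Complex_Order\<close>: \<open>0 \<le> z\<close> means that
  \<open>z\<close> is real and nonnegative. In particular positive semidefinite matrices are Hermitian.
\<close>

definition psd :: "nat \<Rightarrow> complex mat \<Rightarrow> bool" where
  "psd n A \<longleftrightarrow> A \<in> carrier_mat n n \<and> (\<forall>v \<in> carrier_vec n. 0 \<le> (A *\<^sub>v v) \<bullet>c v)"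

definition density :: "nat \<Rightarrow> complex mat set" where
  "density n = {\<rho>. psd n \<rho> \<and> mtrace \<rho> = 1}"

definition linear_op :: "nat \<Rightarrow> nat \<Rightarrow> (complex mat \<Rightarrow> complex mat) \<Rightarrow> bool" where
  "linear_op a b N \<longleftrightarrow>
     (\<forall>X \<in> carrier_mat a a. N X \<in> carrier_mat b b) \<and>
     (\<forall>X \<in> carrier_mat a a. \<forall>Y \<in> carrier_mat a a. N (X + Y) = N X + N Y) \<and>
     (\<forall>c. \<forall>X \<in> carrier_mat a a. N (c \<cdot>\<^sub>m X) = c \<cdot>\<^sub>m N X)"

definition mat_unit :: "nat \<Rightarrow> nat \<Rightarrow> nat \<Rightarrow> complex mat" where
  "mat_unit n i j = mat n n (\<lambda>(p, q). if p = i \<and> q = j then 1 else 0)"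

text \<open>
  The tensor product of linear maps \<open>N\<close> (from \<open>a1 \<times> a1\<close> to \<open>b1 \<times> b1\<close> matrices) and \<open>M\<close> (from
  \<open>a2 \<times> a2\<close> to \<open>b2 \<times> b2\<close> matrices), given by expanding the argument in the basis
  \<open>kron (mat_unit a1 i j) (mat_unit a2 k l)\<close>. It is the linear extension of
  \<open>kron X Y \<mapsto> kron (N X) (M Y)\<close>, see \<open>linear_op_tensor_op\<close> and \<open>tensor_op_kron\<close> below.
\<close>

definition tensor_op ::
    "nat \<Rightarrow> nat \<Rightarrow> (complex mat \<Rightarrow> complex mat) \<Rightarrow>
     nat \<Rightarrow> nat \<Rightarrow> (complex mat \<Rightarrow> complex mat) \<Rightarrow> complex mat \<Rightarrow> complex mat" where
  "tensor_op a1 b1 N a2 b2 M X = mat (b1 * b2) (b1 * b2) (\<lambda>(p, q).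
     \<Sum>i<a1. \<Sum>j<a1. \<Sum>k<a2. \<Sum>l<a2.
       X $$ (i * a2 + k, j * a2 + l) * kron (N (mat_unit a1 i j)) (M (mat_unit a2 k l)) $$ (p, q))"

definition completely_positive :: "nat \<Rightarrow> nat \<Rightarrow> (complex mat \<Rightarrow> complex mat) \<Rightarrow> bool" where
  "completely_positive a b N \<longleftrightarrow>
     (\<forall>r X. psd (r * a) X \<longrightarrow> psd (r * b) (tensor_op r r (\<lambda>Y. Y) a b N X))"

definition cptp :: "nat \<Rightarrow> nat \<Rightarrow> (complex mat \<Rightarrow> complex mat) set" where
  "cptp a b = {N. linear_op a b N \<and> completely_positive a b N \<and>
                  (\<forall>X \<in> carrier_mat a a. mtrace (N X) = mtrace X)}"

text \<open>
  The arguments of a divergence carry their dimension, so one function on matrices represents the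
  whole family of functions on pairs of states. Its values on other arguments are irrelevant.
\<close>

definition state_divergence :: "(complex mat \<Rightarrow> complex mat \<Rightarrow> ereal) \<Rightarrow> bool" where
  "state_divergence D \<longleftrightarrow>
     (\<forall>a. \<forall>\<rho> \<in> density a. \<forall>\<sigma> \<in> density a. D \<rho> \<sigma> \<noteq> - \<infinity>) \<and>
     (\<forall>a b. \<forall>\<rho> \<in> density a. \<forall>\<sigma> \<in> density a. \<forall>E \<in> cptp a b. D (E \<rho>) (E \<sigma>) \<le> D \<rho> \<sigma>)"

definition tensor_additive :: "(complex mat \<Rightarrow> complex mat \<Rightarrow> ereal) \<Rightarrow> bool" where
  "tensor_additive D \<longleftrightarrow>
     (\<forall>a1 a2. \<forall>\<rho>1 \<in> density a1. \<forall>\<sigma>1 \<in> density a1. \<forall>\<rho>2 \<in> density a2. \<forall>\<sigma>2 \<in> density a2.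
        D (kron \<rho>1 \<rho>2) (kron \<sigma>1 \<sigma>2) = D \<rho>1 \<sigma>1 + D \<rho>2 \<sigma>2)"

text \<open>
  The arguments \<open>a\<close> and \<open>b\<close> are the input and output dimension of \<open>N\<close> and \<open>M\<close>, and \<open>r\<close> is the
  dimension of the reference system. In the difference the subtrahend is finite, so no
  \<open>\<infinity> - \<infinity>\<close> arises. If no pair of states has finite divergence, the supremum is \<open>- \<infinity>\<close>.
\<close>

definition amortized_divergence ::
    "(complex mat \<Rightarrow> complex mat \<Rightarrow> ereal) \<Rightarrow> nat \<Rightarrow> nat \<Rightarrow>
     (complex mat \<Rightarrow> complex mat) \<Rightarrow> (complex mat \<Rightarrow> complex mat) \<Rightarrow> ereal" where
  "amortized_divergence D a b N M =
     Sup {D (tensor_op r r (\<lambda>Y. Y) a b N \<rho>) (tensor_op r r (\<lambda>Y. Y) a b M \<sigma>) - D \<rho> \<sigma> | r \<rho> \<sigma>.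
            \<rho> \<in> density (r * a) \<and> \<sigma> \<in> density (r * a) \<and> D \<rho> \<sigma> < \<infinity>}"

lemma linear_op_tensor_op: "linear_op (a1 * a2) (b1 * b2) (tensor_op a1 b1 N a2 b2 M)"
proof -
  have idx: "i * a2 + k < a1 * a2" if "i < a1" "k < a2" for i k
  proof -
    have "i * a2 + k < Suc i * a2" using that by simp
    also have "\<dots> \<le> a1 * a2" using that by (intro mult_le_mono1) simp
    finally show ?thesis .
  qed
  show ?thesis
    unfolding linear_op_def tensor_op_def
    by (auto simp: idx sum.distrib[symmetric] sum_distrib_left distrib_right mult.assoc
        dest: carrier_matD intro!: eq_matI sum.cong)
qed

lemma linear_op_expand:
  assumes N: "linear_op a b N" and X: "X \<in> carrier_mat a a" and p: "p < b" and q: "q < b"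
  shows "N X $$ (p, q) = (\<Sum>i<a. \<Sum>j<a. X $$ (i, j) * N (mat_unit a i j) $$ (p, q))"
proof -
  have *: "finite S \<Longrightarrow> S \<subseteq> {..<a} \<times> {..<a} \<Longrightarrow>
      N (mat a a (\<lambda>ij. if ij \<in> S then X $$ ij else 0)) $$ (p, q)
        = (\<Sum>ij\<in>S. X $$ ij * N (mat_unit a (fst ij) (snd ij)) $$ (p, q))" for S
  proof (induction S rule: finite_induct)
    case empty
    have "mat a a (\<lambda>ij. if ij \<in> {} then X $$ ij else 0) = 0 \<cdot>\<^sub>m X"
      using X by (intro eq_matI) auto
    then show ?case using N X p q unfolding linear_op_def by auto
  next
    case (insert x S)
    let ?m = "\<lambda>S. mat a a (\<lambda>ij. if ij \<in> S then X $$ ij else 0)"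
    let ?u = "mat_unit a (fst x) (snd x)"
    have u: "?u \<in> carrier_mat a a" by (simp add: mat_unit_def)
    have "?m (insert x S) = ?m S + X $$ x \<cdot>\<^sub>m ?u"
      using insert.hyps by (intro eq_matI) (auto simp: mat_unit_def prod_eq_iff)
    then have "N (?m (insert x S)) = N (?m S) + X $$ x \<cdot>\<^sub>m N ?u"
      using N u unfolding linear_op_def by auto
    moreover have "N ?u \<in> carrier_mat b b" "N (?m S) \<in> carrier_mat b b"
      using N u unfolding linear_op_def by auto
    ultimately show ?case using insert p q by (auto simp: add.commute)
  qed
  have "mat a a (\<lambda>ij. if ij \<in> {..<a} \<times> {..<a} then X $$ ij else 0) = X"
    using X by (intro eq_matI) auto
  with *[of "{..<a} \<times> {..<a}"] show ?thesis
    by (simp add: sum.cartesian_product split_def)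
qed

lemma tensor_op_kron:
  assumes N: "linear_op a1 b1 N" and M: "linear_op a2 b2 M"
    and X: "X \<in> carrier_mat a1 a1" and Y: "Y \<in> carrier_mat a2 a2"
  shows "tensor_op a1 b1 N a2 b2 M (kron X Y) = kron (N X) (M Y)"
proof (rule eq_matI)
  have NX: "N X \<in> carrier_mat b1 b1" and MY: "M Y \<in> carrier_mat b2 b2"
    using N M X Y unfolding linear_op_def by auto
  show "dim_row (tensor_op a1 b1 N a2 b2 M (kron X Y)) = dim_row (kron (N X) (M Y))"
    "dim_col (tensor_op a1 b1 N a2 b2 M (kron X Y)) = dim_col (kron (N X) (M Y))"
    using NX MY by (auto simp: tensor_op_def kron_def)
  fix p q assume "p < dim_row (kron (N X) (M Y))" "q < dim_col (kron (N X) (M Y))"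
  then have p: "p < b1 * b2" and q: "q < b1 * b2" using NX MY by (auto simp: kron_def)
  have b2: "b2 > 0" using p by (cases b2) auto
  have pq: "p div b2 < b1" "q div b2 < b1" "p mod b2 < b2" "q mod b2 < b2"
    using p q b2 by (auto simp: less_mult_imp_div_less)
  have U: "N (mat_unit a1 i j) \<in> carrier_mat b1 b1" "M (mat_unit a2 k l) \<in> carrier_mat b2 b2"
    for i j k l using N M unfolding linear_op_def by (auto simp: mat_unit_def)
  have Ud: "dim_row (N (mat_unit a1 i j)) = b1" "dim_col (N (mat_unit a1 i j)) = b1"
    "dim_row (M (mat_unit a2 k l)) = b2" "dim_col (M (mat_unit a2 k l)) = b2" for i j k l
    using U(1)[of i j] U(2)[of k l] by (simp_all only: carrier_matD)
  have idx: "i * a2 + k < a1 * a2" if "i < a1" "k < a2" for i k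
  proof -
    have "i * a2 + k < Suc i * a2" using that by simp
    also have "\<dots> \<le> a1 * a2" using that by (intro mult_le_mono1) simp
    finally show ?thesis .
  qed
  have k1: "kron X Y $$ (i * a2 + k, j * a2 + l) = X $$ (i, j) * Y $$ (k, l)"
    if "i < a1" "j < a1" "k < a2" "l < a2" for i j k l
    using X Y that idx[of i k] idx[of j l] by (auto simp: kron_def)
  have k2: "kron (N (mat_unit a1 i j)) (M (mat_unit a2 k l)) $$ (p, q)
      = N (mat_unit a1 i j) $$ (p div b2, q div b2) * M (mat_unit a2 k l) $$ (p mod b2, q mod b2)"
    for i j k l using p q by (simp add: kron_def Ud)
  have "tensor_op a1 b1 N a2 b2 M (kron X Y) $$ (p, q) =
     (\<Sum>i<a1. \<Sum>j<a1. \<Sum>k<a2. \<Sum>l<a2.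
       (X $$ (i, j) * N (mat_unit a1 i j) $$ (p div b2, q div b2)) *
       (Y $$ (k, l) * M (mat_unit a2 k l) $$ (p mod b2, q mod b2)))"
    using p q unfolding tensor_op_def by (auto simp: k1 k2 mult_ac intro!: sum.cong)
  also have "\<dots> = N X $$ (p div b2, q div b2) * M Y $$ (p mod b2, q mod b2)"
    unfolding linear_op_expand[OF N X pq(1,2)] linear_op_expand[OF M Y pq(3,4)]
    by (simp only: sum_distrib_right) (simp only: sum_distrib_left)
  also have "\<dots> = kron (N X) (M Y) $$ (p, q)"
    using NX MY p q by (auto simp: kron_def)
  finally show "tensor_op a1 b1 N a2 b2 M (kron X Y) $$ (p, q) = kron (N X) (M Y) $$ (p, q)" .
qed

end

(*
  Upper bound: N1 \<otimes> N2 acts on R A1 A2 first as N2 with reference R A1 and then as N1 with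
  reference R B2, and the two divergence differences telescope. Lower bound: a product of two
  input pairs is an input pair for N1 \<otimes> N2 on which additivity splits the difference. In both
  directions tensor factors have to be reordered, which is a channel with an inverse channel and so
  preserves the divergence.

  The sum of the two suprema is only meaningful because they are nonnegative. Replacing a state
  by a fixed state tau is a channel, so D(tau, tau) is the least value of D; by additivity it is 0
  unless D is identically infinite on states, in which case all three suprema are - \<infinity>.
*)
theory Submission
  imports Defs
begin

section \<open>Indices of tensor products as two-digit numbers\<close>

lemma pair_index_less: "i * n + k < m * n" if "i < m" "k < n" for i k m n :: nat
proof -
  have "i * n + k < Suc i * n" using that by simp
  also have "\<dots> \<le> m * n" using that by (intro mult_le_mono1) simp
  finally show ?thesis .
qed

lemma pair_index_cases:
  fixes p m n :: nat
  assumes "p < m * n"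
  obtains i k where "i < m" "k < n" "p = i * n + k"
proof
  have "n > 0" using assms by (cases n) auto
  then show "p mod n < n" by simp
  show "p div n < m" using assms by (simp add: less_mult_imp_div_less)
qed simp

lemma sum_pair_index: "(\<Sum>p<m * n. f p) = (\<Sum>i<m. \<Sum>k<n. f (i * n + k))"
  for f :: "nat \<Rightarrow> 'a::comm_monoid_add"
proof -
  have "sum f {i * n..<i * n + n} = (\<Sum>k<n. f (i * n + k))" for i
    using sum.shift_bounds_nat_ivl[of f 0 "i * n" n] by (simp add: add.commute atLeast0LessThan)
  then show ?thesis by (simp add: sum.nat_group[symmetric])
qed

lemma eq_mat_pairI:
  assumes "A \<in> carrier_mat (m * n) (m * n)" "B \<in> carrier_mat (m * n) (m * n)"
    and "\<And>i j k l. i < m \<Longrightarrow> j < m \<Longrightarrow> k < n \<Longrightarrow> l < n \<Longrightarrow>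
      A $$ (i * n + k, j * n + l) = B $$ (i * n + k, j * n + l)"
  shows "A = B"
proof (rule eq_matI)
  fix p q assume "p < dim_row B" "q < dim_col B"
  then have "p < m * n" "q < m * n" using assms by auto
  then show "A $$ (p, q) = B $$ (p, q)" by (metis assms(3) pair_index_cases)
qed (use assms in auto)

text \<open>Entries of matrix units and of reindexed matrices appear in sums as such products of
  Kronecker deltas, each of which selects one term.\<close>

lemma sum_if_if:
  fixes f :: "nat \<Rightarrow> nat \<Rightarrow> complex"
  assumes "s < m" "t < n"
  shows "(\<Sum>i<m. \<Sum>j<n. f i j * (if s = i \<and> t = j then 1 else 0)) = f s t"
proof -
  have "(\<Sum>i<m. \<Sum>j<n. f i j * (if s = i \<and> t = j then 1 else 0))
      = (\<Sum>i<m. if s = i then \<Sum>j<n. if t = j then f i j else 0 else 0)"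
    using assms by (intro sum.cong refl)
      (auto simp: if_distrib[of "\<lambda>x. _ * x"] cong: if_cong split: if_split)
  also have "\<dots> = f s t" using assms by simp
  finally show ?thesis .
qed

section \<open>Positive semidefinite matrices\<close>

text \<open>Positivity is stated for coefficient functions, read only below \<open>n\<close>, so
  that an induction on the dimension can restrict to a leading block or pass to a Schur complement
  without resizing matrices.\<close>

definition pos_form :: "nat \<Rightarrow> (nat \<Rightarrow> nat \<Rightarrow> complex) \<Rightarrow> bool" where
  "pos_form n A \<longleftrightarrow> (\<forall>x. 0 \<le> (\<Sum>i<n. \<Sum>j<n. A i j * x j * cnj (x i)))"

lemma psd_iff_pos_form:
  "psd n A \<longleftrightarrow> A \<in> carrier_mat n n \<and> pos_form n (\<lambda>i j. A $$ (i, j))"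
proof (cases "A \<in> carrier_mat n n")
  case A: True
  have quad: "(A *\<^sub>v v) \<bullet>c v = (\<Sum>i<n. \<Sum>j<n. A $$ (i, j) * v $ j * cnj (v $ i))"
    if "v \<in> carrier_vec n" for v
    using A that
    by (auto simp: scalar_prod_def sum_distrib_right atLeast0LessThan intro!: sum.cong)
  have "(\<forall>v \<in> carrier_vec n. 0 \<le> (A *\<^sub>v v) \<bullet>c v) \<longleftrightarrow> pos_form n (\<lambda>i j. A $$ (i, j))"
    unfolding pos_form_def
  proof (intro iffI ballI allI)
    fix x assume "\<forall>v \<in> carrier_vec n. 0 \<le> (A *\<^sub>v v) \<bullet>c v"
    then have "0 \<le> (A *\<^sub>v vec n x) \<bullet>c vec n x" by simp
    then show "0 \<le> (\<Sum>i<n. \<Sum>j<n. A $$ (i, j) * x j * cnj (x i))"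
      by (simp add: quad)
  qed (simp add: quad)
  then show ?thesis using A by (simp add: psd_def)
qed (simp add: psd_def)

lemma pos_formD: "pos_form n A \<Longrightarrow> 0 \<le> (\<Sum>i<n. \<Sum>j<n. A i j * x j * cnj (x i))"
  by (simp add: pos_form_def)

text \<open>The quadratic form at the vector \<open>x\<close> with last coordinate \<open>y\<close>,
  expanded along that coordinate. The facts below result from special choices of \<open>x\<close>
  and \<open>y\<close>.\<close>

lemma pos_form_Suc: "pos_form (Suc n) A \<Longrightarrow>
  0 \<le> (\<Sum>i<n. \<Sum>j<n. A i j * x j * cnj (x i)) + cnj y * (\<Sum>j<n. A n j * x j)
      + y * (\<Sum>i<n. A i n * cnj (x i)) + A n n * y * cnj y"
proof -
  assume "pos_form (Suc n) A"
  from pos_formD[OF this, of "x(n := y)"] show ?thesis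
    by (simp add: sum.distrib sum_distrib_left algebra_simps)
qed

lemma pos_form_lower: "pos_form (Suc n) A \<Longrightarrow> pos_form n A"
  unfolding pos_form_def[of n] using pos_form_Suc[of n A _ 0] by simp

text \<open>Taking \<open>x\<close> to be the unit vector at \<open>i\<close> leaves the form of the
  two-by-two principal submatrix on the indices \<open>i\<close> and \<open>n\<close>.\<close>

lemma pos_form_Suc_unit:
  assumes "pos_form (Suc n) A" "i < n"
  shows "0 \<le> A i i + cnj y * A n i + y * A i n + A n n * y * cnj y"
proof -
  have "(\<Sum>k<n. \<Sum>l<n. A k l * (if l = i then 1 else 0) * cnj (if k = i then 1 else 0))
      = (\<Sum>k<n. \<Sum>l<n. A k l * (if i = k \<and> i = l then 1 else 0))"
    by (intro sum.cong) auto
  also have "\<dots> = A i i" using sum_if_if[OF assms(2,2)] .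
  finally show ?thesis
    using pos_form_Suc[OF assms(1), of "\<lambda>k. if k = i then 1 else 0" y] assms(2)
    by (simp add: if_distrib[of "\<lambda>x. _ * x"] if_distrib[of cnj] cong: if_cong)
qed

lemma pos_form_Suc_diag: "pos_form (Suc n) A \<Longrightarrow> 0 \<le> A n n"
  using pos_form_Suc[of n A "\<lambda>_. 0" 1] by simp

lemma pos_form_diag:
  assumes "pos_form n A" "i < n" shows "0 \<le> A i i"
  using assms
proof (induction n)
  case (Suc n)
  then show ?case using pos_form_lower[of n A] pos_form_Suc_diag[of n A]
    by (cases "i = n") auto
qed simp

text \<open>Polarization: the form is real, so \<open>y = 1\<close> makes the imaginary parts of the
  two entries opposite and \<open>y = \<i>\<close> makes their real parts equal.\<close>

lemma pos_form_Suc_hermitian: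
  assumes "pos_form (Suc n) A" "i < n"
  shows "A n i = cnj (A i n)"
proof -
  have i: "Im (A i i) = 0" and n: "Im (A n n) = 0"
    using pos_form_diag[OF assms(1), of i] pos_form_diag[OF assms(1), of n] assms(2)
    by (auto simp: less_eq_complex_def)
  have "Im (A n i + A i n) = 0"
    using pos_form_Suc_unit[OF assms, of 1] i n by (auto simp: less_eq_complex_def)
  moreover have "Re (A i n) = Re (A n i)"
    using pos_form_Suc_unit[OF assms, of \<i>] i n by (auto simp: less_eq_complex_def)
  ultimately show ?thesis by (auto simp: complex_eq_iff)
qed

text \<open>With a vanishing corner the form has no term quadratic in \<open>y\<close>, so a nonzero
  off-diagonal entry would let it become negative.\<close>

lemma pos_form_Suc_null:
  assumes "pos_form (Suc n) A" "i < n" "A n n = 0"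
  shows "A i n = 0"
proof (rule ccontr)
  assume nz: "A i n \<noteq> 0"
  \<comment> \<open>Chosen so that at \<open>y = - t * cnj (A i n)\<close> the form equals
    \<open>A i i - 2 * (Re (A i i) + 1)\<close>, which is negative because \<open>A i i\<close> is
    nonnegative.\<close>
  define t where "t = (Re (A i i) + 1) / (cmod (A i n))\<^sup>2"
  have "0 \<le> A i i + cnj (- t * cnj (A i n)) * A n i + (- t * cnj (A i n)) * A i n"
    using pos_form_Suc_unit[OF assms(1,2), of "- t * cnj (A i n)"] assms(3) by simp
  also have "\<dots> = A i i - 2 * t * (cmod (A i n))\<^sup>2"
    by (simp add: pos_form_Suc_hermitian[OF assms(1,2)] complex_norm_square del: of_real_power)
  also have "complex_of_real (2 * t * (cmod (A i n))\<^sup>2) = of_real (2 * (Re (A i i) + 1))"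
    using nz by (simp add: t_def)
  finally have "2 * (Re (A i i) + 1) \<le> Re (A i i)" by (simp add: less_eq_complex_def)
  moreover have "0 \<le> Re (A i i)"
    using pos_form_diag[OF assms(1), of i] assms(2) by (simp add: less_eq_complex_def)
  ultimately show False by simp
qed

text \<open>Completing the square: the form of the Schur complement at \<open>x\<close> is the form
  of \<open>A\<close> at \<open>x\<close> extended by the minimizing last coordinate
  \<open>- s / A n n\<close>.\<close>

lemma pos_form_schur_complement:
  assumes "pos_form (Suc n) A" "A n n \<noteq> 0"
  shows "pos_form n (\<lambda>i j. A i j - A i n * A n j / A n n)"
  unfolding pos_form_def
proof
  fix x
  define s where "s = (\<Sum>j<n. A n j * x j)"
  have cnj_a: "cnj (A n n) = A n n"
    using pos_form_Suc_diag[OF assms(1)] by (auto simp: less_eq_complex_def complex_eq_iff)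
  have cnj_s: "(\<Sum>i<n. A i n * cnj (x i)) = cnj s"
    using pos_form_Suc_hermitian[OF assms(1)] by (simp add: s_def)
  have "(\<Sum>i<n. \<Sum>j<n. (A i j - A i n * A n j / A n n) * x j * cnj (x i))
      = (\<Sum>i<n. \<Sum>j<n. A i j * x j * cnj (x i))
        - (\<Sum>i<n. \<Sum>j<n. (A i n * cnj (x i)) * (A n j * x j)) / A n n"
    by (simp add: sum_subtractf sum_divide_distrib algebra_simps)
  also have "(\<Sum>i<n. \<Sum>j<n. (A i n * cnj (x i)) * (A n j * x j)) = cnj s * s"
    by (simp add: sum_product[symmetric] cnj_s s_def[symmetric])
  also have "(\<Sum>i<n. \<Sum>j<n. A i j * x j * cnj (x i)) - cnj s * s / A n n
      = (\<Sum>i<n. \<Sum>j<n. A i j * x j * cnj (x i)) + cnj (- s / A n n) * s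
        + (- s / A n n) * cnj s + A n n * (- s / A n n) * cnj (- s / A n n)"
    using assms(2) by (simp add: cnj_a field_simps)
  also have "0 \<le> \<dots>"
    using pos_form_Suc[OF assms(1), of x "- s / A n n"] by (simp only: s_def[symmetric] cnj_s)
  finally show "0 \<le> (\<Sum>i<n. \<Sum>j<n. (A i j - A i n * A n j / A n n) * x j * cnj (x i))" .
qed

text \<open>Cholesky decomposition: the last row is split off by passing to the Schur complement.\<close>

lemma pos_form_gram:
  assumes "pos_form n A"
  shows "\<exists>m w. \<forall>i<n. \<forall>j<n. A i j = (\<Sum>k<m::nat. w k i * cnj (w k j))"
  using assms
proof (induction n arbitrary: A)
  case (Suc n)
  show ?case
  proof (cases "A n n = 0")
    case True
    have 1: "A i n = 0" if "i < n" for i using pos_form_Suc_null[OF Suc.prems that True] .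
    have 2: "A n i = 0" if "i < n" for i
      using pos_form_Suc_hermitian[OF Suc.prems that] 1[OF that] by simp
    obtain m w where w: "A i j = (\<Sum>k<m::nat. w k i * cnj (w k j))" if "i < n" "j < n" for i j
      using Suc.IH[OF pos_form_lower[OF Suc.prems]] by blast
    \<comment> \<open>The last row and column vanish, so the vectors for the leading block are
      extended by zero.\<close>
    show ?thesis
      by (intro exI[of _ m] exI[of _ "\<lambda>k i. if i < n then w k i else 0"])
        (auto simp: less_Suc_eq w 1 2 True)
  next
    case False
    define c where "c = complex_of_real (sqrt (Re (A n n)))"
    have c: "c * cnj c = A n n" "cnj c = c"
      using pos_form_Suc_diag[OF Suc.prems]
      by (auto simp: c_def less_eq_complex_def complex_eq_iff)
    have c0: "c \<noteq> 0" using c False by auto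
    obtain m w where w: "A i j - A i n * A n j / A n n = (\<Sum>k<m::nat. w k i * cnj (w k j))"
      if "i < n" "j < n" for i j
      using Suc.IH[OF pos_form_schur_complement[OF Suc.prems False]] by blast
    \<comment> \<open>The additional vector, the last column over the square root of the corner,
      restores the rank-one term removed by the Schur complement and produces the whole last row and
      column; the old vectors vanish at \<open>n\<close>.\<close>
    define u where "u k i = (if k = m then A i n / c else if i < n then w k i else 0)" for k i
    have herm: "cnj (A j n) = A n j" if "j < Suc n" for j
      using that pos_form_Suc_hermitian[OF Suc.prems, of j] c
      by (cases "j = n") (auto, metis complex_cnj_mult)
    have last: "A i n / c * cnj (A j n / c) = A i n * A n j / A n n" if "j < Suc n" for i j
      using c by (simp add: herm[OF that])
    have "A i j = (\<Sum>k<Suc m. u k i * cnj (u k j))" if "i < Suc n" "j < Suc n" for i j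
    proof -
      have "(\<Sum>k<Suc m. u k i * cnj (u k j))
          = (\<Sum>k<m. (if i < n then w k i else 0) * cnj (if j < n then w k j else 0))
            + A i n * A n j / A n n"
        using last[OF that(2), of i] by (simp add: u_def)
      also have "\<dots> = A i j"
        using that w[of i j] False by (auto simp: less_Suc_eq if_distrib cong: if_cong simp flip: w)
      finally show ?thesis by simp
    qed
    then show ?thesis by blast
  qed
qed simp

section \<open>Tensor products of positive semidefinite matrices\<close>

lemma kron_index:
  assumes "A \<in> carrier_mat m m" "B \<in> carrier_mat n n" "i < m" "j < m" "k < n" "l < n"
  shows "kron A B $$ (i * n + k, j * n + l) = A $$ (i, j) * B $$ (k, l)"
  using assms pair_index_less[of i m k n] pair_index_less[of j m l n] by (auto simp: kron_def)

lemma kron_carrier: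
  "A \<in> carrier_mat m m \<Longrightarrow> B \<in> carrier_mat n n \<Longrightarrow> kron A B \<in> carrier_mat (m * n) (m * n)"
  by (auto simp: kron_def)

text \<open>Writing \<open>B\<close> as a sum of rank-one matrices turns the form of the tensor
  product into a sum of values of the form of \<open>A\<close>.\<close>

lemma psd_kron:
  assumes "psd m A" "psd n B"
  shows "psd (m * n) (kron A B)"
proof -
  have A: "A \<in> carrier_mat m m" and fA: "pos_form m (\<lambda>i j. A $$ (i, j))"
    and B: "B \<in> carrier_mat n n" and fB: "pos_form n (\<lambda>i j. B $$ (i, j))"
    using assms by (auto simp: psd_iff_pos_form)
  obtain h w where w: "B $$ (i, j) = (\<Sum>k<h::nat. w k i * cnj (w k j))" if "i < n" "j < n" for i j
    using pos_form_gram[OF fB] by blast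
  have "0 \<le> (\<Sum>p<m * n. \<Sum>q<m * n. kron A B $$ (p, q) * x q * cnj (x p))" for x
  proof -
    \<comment> \<open>The vector \<open>x\<close> with its second factor contracted against the Gram
      vector \<open>w c\<close>.\<close>
    define y where "y c j = (\<Sum>l<n. cnj (w c l) * x (j * n + l))" for c j
    have "(\<Sum>p<m * n. \<Sum>q<m * n. kron A B $$ (p, q) * x q * cnj (x p))
        = (\<Sum>i<m. \<Sum>k<n. \<Sum>j<m. \<Sum>l<n. \<Sum>c<h.
            A $$ (i, j) * (cnj (w c l) * x (j * n + l)) * (w c k * cnj (x (i * n + k))))"
      unfolding sum_pair_index
      by (intro sum.cong refl)
        (auto simp: kron_index[OF A B] w sum_distrib_left sum_distrib_right mult_ac
          intro!: sum.cong)
    also have "\<dots> = (\<Sum>c<h. \<Sum>i<m. \<Sum>j<m. \<Sum>k<n. \<Sum>l<n.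
            A $$ (i, j) * (cnj (w c l) * x (j * n + l)) * (w c k * cnj (x (i * n + k))))"
      by (simp only: sum.swap[where B = "{..<h}"] sum.swap[where A = "{..<n}" and B = "{..<m}"])
    also have "\<dots> = (\<Sum>c<h. \<Sum>i<m. \<Sum>j<m. A $$ (i, j) * (cnj (y c i) * y c j))"
      by (simp only: y_def cnj_sum complex_cnj_mult complex_cnj_cnj sum_product)
        (simp only: sum_distrib_left mult_ac)
    also have "0 \<le> \<dots>"
    proof (rule sum_nonneg)
      fix c
      show "0 \<le> (\<Sum>i<m. \<Sum>j<m. A $$ (i, j) * (cnj (y c i) * y c j))"
        using pos_formD[OF fA, of "y c"] by (simp add: mult_ac)
    qed
    finally show ?thesis .
  qed
  then show ?thesis using kron_carrier[OF A B] by (simp add: psd_iff_pos_form pos_form_def)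
qed

section \<open>Channels\<close>

lemma mat_unit_carrier: "mat_unit n i j \<in> carrier_mat n n"
  by (simp add: mat_unit_def)

lemma linear_op_id: "linear_op r r (\<lambda>Y. Y)"
  by (simp add: linear_op_def)

lemma linear_op_carrier: "linear_op a b N \<Longrightarrow> X \<in> carrier_mat a a \<Longrightarrow> N X \<in> carrier_mat b b"
  by (simp add: linear_op_def)

lemma tensor_op_carrier: "tensor_op a1 b1 N a2 b2 M X \<in> carrier_mat (b1 * b2) (b1 * b2)"
  by (simp add: tensor_op_def)

lemma tensor_op_index:
  assumes "linear_op a1 b1 N" "linear_op a2 b2 M" "s1 < b1" "t1 < b1" "s2 < b2" "t2 < b2"
  shows "tensor_op a1 b1 N a2 b2 M X $$ (s1 * b2 + s2, t1 * b2 + t2) =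
    (\<Sum>i<a1. \<Sum>j<a1. \<Sum>k<a2. \<Sum>l<a2. X $$ (i * a2 + k, j * a2 + l) *
      (N (mat_unit a1 i j) $$ (s1, t1) * M (mat_unit a2 k l) $$ (s2, t2)))"
  using assms kron_index[OF linear_op_carrier[OF assms(1) mat_unit_carrier]
      linear_op_carrier[OF assms(2) mat_unit_carrier] assms(3-)]
  by (simp add: tensor_op_def pair_index_less)

abbreviation ampl where
  "ampl r a b N \<equiv> tensor_op r r (\<lambda>Y. Y) a b N"

text \<open>The matrix units of the reference system select one block: the amplified map applies
  \<open>N\<close> to each \<open>a\<close> by \<open>a\<close> block of \<open>X\<close>
  separately.\<close>

lemma ampl_index:
  assumes "linear_op a b N" "i < r" "j < r" "s < b" "t < b"
  shows "ampl r a b N X $$ (i * b + s, j * b + t) =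
    (\<Sum>k<a. \<Sum>l<a. X $$ (i * a + k, j * a + l) * N (mat_unit a k l) $$ (s, t))"
proof -
  have "ampl r a b N X $$ (i * b + s, j * b + t) =
      (\<Sum>i'<r. \<Sum>j'<r. (\<Sum>k<a. \<Sum>l<a. X $$ (i' * a + k, j' * a + l) * N (mat_unit a k l) $$ (s, t))
        * (if i = i' \<and> j = j' then 1 else 0))"
    unfolding tensor_op_index[OF linear_op_id assms]
    using assms by (intro sum.cong refl) (auto simp: mat_unit_def)
  also have "\<dots> = (\<Sum>k<a. \<Sum>l<a. X $$ (i * a + k, j * a + l) * N (mat_unit a k l) $$ (s, t))"
    by (rule sum_if_if[OF assms(2,3)])
  finally show ?thesis .
qed

lemma mtrace_pair:
  "A \<in> carrier_mat (m * n) (m * n) \<Longrightarrow> mtrace A = (\<Sum>i<m. \<Sum>k<n. A $$ (i * n + k, i * n + k))"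
  by (auto simp: mtrace_def sum_pair_index)

lemma mtrace_mat_unit: "k < a \<Longrightarrow> l < a \<Longrightarrow> mtrace (mat_unit a k l) = (if k = l then 1 else 0)"
  by (auto simp: mtrace_def mat_unit_def intro!: sum.neutral)

lemma cptpD:
  assumes "N \<in> cptp a b"
  shows "linear_op a b N" "completely_positive a b N"
    "X \<in> carrier_mat a a \<Longrightarrow> mtrace (N X) = mtrace X"
  using assms by (auto simp: cptp_def)

text \<open>On matrix units, trace preservation says that the trace of
  \<open>N (mat_unit a k l)\<close> is the Kronecker delta of \<open>k\<close> and \<open>l\<close>;
  the block formula carries this over to the amplified map.\<close>

lemma mtrace_ampl:
  assumes "N \<in> cptp a b" "X \<in> carrier_mat (r * a) (r * a)"
  shows "mtrace (ampl r a b N X) = mtrace X"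
proof -
  note N = cptpD[OF assms(1)]
  have tr: "(\<Sum>s<b. N (mat_unit a k l) $$ (s, s)) = (if k = l then 1 else 0)" if "k < a" "l < a" for k l
  proof -
    have "dim_row (N (mat_unit a k l)) = b"
      using linear_op_carrier[OF N(1) mat_unit_carrier] by auto
    then show ?thesis
      using N(3)[OF mat_unit_carrier, of k l] mtrace_mat_unit[OF that]
      by (simp add: mtrace_def[of "N _"])
  qed
  have "mtrace (ampl r a b N X) = (\<Sum>i<r. \<Sum>s<b. \<Sum>k<a. \<Sum>l<a.
      X $$ (i * a + k, i * a + l) * N (mat_unit a k l) $$ (s, s))"
    unfolding mtrace_pair[OF tensor_op_carrier]
    by (intro sum.cong refl) (simp add: ampl_index[OF N(1)])
  also have "\<dots> = (\<Sum>i<r. \<Sum>k<a. \<Sum>s<b. \<Sum>l<a.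
      X $$ (i * a + k, i * a + l) * N (mat_unit a k l) $$ (s, s))"
    by (intro sum.cong refl sum.swap)
  also have "\<dots> = (\<Sum>i<r. \<Sum>k<a. \<Sum>l<a. \<Sum>s<b.
      X $$ (i * a + k, i * a + l) * N (mat_unit a k l) $$ (s, s))"
    by (intro sum.cong refl sum.swap)
  also have "\<dots> = (\<Sum>i<r. \<Sum>k<a. \<Sum>l<a.
      X $$ (i * a + k, i * a + l) * (if k = l then 1 else 0))"
    by (intro sum.cong refl) (simp add: sum_distrib_left[symmetric] tr)
  also have "\<dots> = mtrace X"
    unfolding mtrace_pair[OF assms(2)]
    by (intro sum.cong refl) (simp add: if_distrib[of "\<lambda>x. _ * x"] cong: if_cong)
  finally show ?thesis .
qed

lemma densityD: "\<rho> \<in> density n \<Longrightarrow> \<rho> \<in> carrier_mat n n"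
  by (simp add: density_def psd_def)

lemma ampl_density:
  assumes "N \<in> cptp a b" "\<rho> \<in> density (r * a)"
  shows "ampl r a b N \<rho> \<in> density (r * b)"
  using assms mtrace_ampl[OF assms(1) densityD[OF assms(2)]] cptpD(2)[OF assms(1)]
  by (simp add: density_def completely_positive_def)

lemma kron_density:
  assumes "\<rho> \<in> density m" "\<sigma> \<in> density n"
  shows "kron \<rho> \<sigma> \<in> density (m * n)"
proof -
  have "mtrace (kron \<rho> \<sigma>) = mtrace \<rho> * mtrace \<sigma>"
    unfolding mtrace_pair[OF kron_carrier[OF assms[THEN densityD]]]
    using assms[THEN densityD] kron_index[OF assms[THEN densityD]]
    by (auto simp: mtrace_def sum_product)
  then show ?thesis using assms by (simp add: density_def psd_kron)
qed

text \<open>The form at \<open>x\<close> is the squared modulus of \<open>x 0\<close>. This provides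
  a state in every positive dimension.\<close>

lemma mat_unit_density: "0 < n \<Longrightarrow> mat_unit n 0 0 \<in> density n"
proof -
  assume n: "0 < n"
  have "(\<Sum>i<n. \<Sum>j<n. mat_unit n 0 0 $$ (i, j) * x j * cnj (x i)) = x 0 * cnj (x 0)" for x
  proof -
    have "(\<Sum>i<n. \<Sum>j<n. mat_unit n 0 0 $$ (i, j) * x j * cnj (x i))
        = (\<Sum>i<n. \<Sum>j<n. x j * cnj (x i) * (if 0 = i \<and> 0 = j then 1 else 0))"
      by (intro sum.cong refl) (simp add: mat_unit_def)
    also have "\<dots> = x 0 * cnj (x 0)" by (rule sum_if_if[OF n n])
    finally show ?thesis .
  qed
  then have "pos_form n (\<lambda>i j. mat_unit n 0 0 $$ (i, j))"
    by (simp add: pos_form_def) (simp add: less_eq_complex_def)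
  then show ?thesis
    using n by (simp add: density_def psd_iff_pos_form mat_unit_carrier mtrace_mat_unit)
qed

text \<open>The compression of \<open>X\<close> by the linear map V sending basis vector
  \<open>p\<close> to basis vector \<open>f p\<close>, that is, the adjoint of V times
  \<open>X\<close> times V. For a permutation \<open>f\<close> it is a unitary conjugation.
  \<open>n\<close> is the output dimension.\<close>

definition reindex :: "nat \<Rightarrow> (nat \<Rightarrow> nat) \<Rightarrow> complex mat \<Rightarrow> complex mat" where
  "reindex n f X = mat n n (\<lambda>(p, q). X $$ (f p, f q))"

lemma reindex_carrier: "reindex n f X \<in> carrier_mat n n"
  by (simp add: reindex_def)

lemma reindex_index: "p < n \<Longrightarrow> q < n \<Longrightarrow> reindex n f X $$ (p, q) = X $$ (f p, f q)"
  by (simp add: reindex_def)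

text \<open>The form of the compressed matrix at \<open>x\<close> is the form of \<open>X\<close> at
  the image of \<open>x\<close>. Besides permutations, this covers the passage to principal
  submatrices.\<close>

lemma psd_reindex:
  assumes X: "psd n X" and f: "\<And>p. p < m \<Longrightarrow> f p < n"
  shows "psd m (reindex m f X)"
proof -
  have "0 \<le> (\<Sum>p<m. \<Sum>q<m. reindex m f X $$ (p, q) * x q * cnj (x p))" for x
  proof -
    \<comment> \<open>The push-forward of \<open>x\<close> along \<open>f\<close>.\<close>
    define y where "y i = (\<Sum>p<m. x p * (if f p = i then 1 else 0))" for i
    have "(\<Sum>p<m. \<Sum>q<m. reindex m f X $$ (p, q) * x q * cnj (x p))
        = (\<Sum>p<m. \<Sum>q<m. \<Sum>i<n. \<Sum>j<n. (X $$ (i, j) * x q * cnj (x p))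
            * (if f p = i \<and> f q = j then 1 else 0))"
      by (intro sum.cong refl) (simp add: sum_if_if f reindex_index)
    also have "\<dots> = (\<Sum>i<n. \<Sum>j<n. \<Sum>p<m. \<Sum>q<m. (X $$ (i, j) * x q * cnj (x p))
            * (if f p = i \<and> f q = j then 1 else 0))"
      by (simp only: sum.swap[where A = "{..<m}" and B = "{..<n}"])
    also have "\<dots> = (\<Sum>i<n. \<Sum>j<n. \<Sum>p<m. \<Sum>q<m. X $$ (i, j) *
            ((cnj (x p) * (if f p = i then 1 else 0)) * (x q * (if f q = j then 1 else 0))))"
      by (intro sum.cong refl) simp
    also have "\<dots> = (\<Sum>i<n. \<Sum>j<n. X $$ (i, j) * (cnj (y i) * y j))"
      unfolding y_def cnj_sum sum_product
      by (simp add: sum_distrib_left if_distrib[of cnj] cong: if_cong)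
    also have "0 \<le> \<dots>"
      using X pos_formD[of n "\<lambda>i j. X $$ (i, j)" y] by (simp add: psd_iff_pos_form mult_ac)
    finally show ?thesis .
  qed
  then show ?thesis by (simp add: psd_iff_pos_form pos_form_def reindex_carrier)
qed

lemma mtrace_reindex:
  assumes "X \<in> carrier_mat n n" "bij_betw f {..<n} {..<n}"
  shows "mtrace (reindex n f X) = mtrace X"
  using assms sum.reindex_bij_betw[OF assms(2), of "\<lambda>i. X $$ (i, i)"]
  by (simp add: mtrace_def reindex_def)

lemma reindex_density:
  assumes "\<rho> \<in> density n" "bij_betw f {..<n} {..<n}"
  shows "reindex n f \<rho> \<in> density n"
  using assms mtrace_reindex[OF densityD[OF assms(1)] assms(2)] psd_reindex[of n \<rho> n f]
    bij_betwE[OF assms(2)]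
  by (auto simp: density_def)

lemma linear_op_reindex: "(\<And>p. p < b \<Longrightarrow> f p < a) \<Longrightarrow> linear_op a b (reindex b f)"
  by (auto simp: linear_op_def reindex_def intro!: eq_matI)

text \<open>Amplifying a reindexing gives a reindexing again, which preserves positivity.\<close>

lemma completely_positive_reindex:
  assumes f: "\<And>p. p < b \<Longrightarrow> f p < a"
  shows "completely_positive a b (reindex b f)"
  unfolding completely_positive_def
proof (intro allI impI)
  fix r X assume X: "psd (r * a) X"
  \<comment> \<open>\<open>g\<close> keeps the reference digit and applies \<open>f\<close> to the
    system digit.\<close>
  define g where "g p = p div b * a + f (p mod b)" for p
  have g: "g (i * b + s) = i * a + f s" if "s < b" for i s
    using that by (simp add: g_def)
  have "ampl r a b (reindex b f) X = reindex (r * b) g X"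
  proof (rule eq_mat_pairI[OF tensor_op_carrier reindex_carrier])
    fix i j s t assume *: "i < r" "j < r" "s < b" "t < b"
    have "ampl r a b (reindex b f) X $$ (i * b + s, j * b + t)
        = (\<Sum>k<a. \<Sum>l<a. X $$ (i * a + k, j * a + l) * (if f s = k \<and> f t = l then 1 else 0))"
      using * f by (simp add: ampl_index[OF linear_op_reindex[OF f]] reindex_index mat_unit_def)
    also have "\<dots> = X $$ (i * a + f s, j * a + f t)"
      using * f by (intro sum_if_if) auto
    also have "\<dots> = reindex (r * b) g X $$ (i * b + s, j * b + t)"
      using * by (simp add: reindex_index pair_index_less g)
    finally show "ampl r a b (reindex b f) X $$ (i * b + s, j * b + t)
        = reindex (r * b) g X $$ (i * b + s, j * b + t)" .
  qed
  moreover have "psd (r * b) (reindex (r * b) g X)"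
  proof (rule psd_reindex[OF X])
    fix p assume "p < r * b"
    then obtain i s where "i < r" "s < b" "p = i * b + s" by (rule pair_index_cases)
    then show "g p < r * a" by (simp add: g f pair_index_less)
  qed
  ultimately show "psd (r * b) (ampl r a b (reindex b f) X)" by simp
qed

lemma reindex_cptp: "bij_betw f {..<n} {..<n} \<Longrightarrow> reindex n f \<in> cptp n n"
  using bij_betwE[of f "{..<n}" "{..<n}"]
  by (auto simp: cptp_def mtrace_reindex intro!: linear_op_reindex completely_positive_reindex)

text \<open>The channel that discards its input and prepares \<tau>; the trace factor makes it
  linear and equals 1 on states.\<close>

definition replacer :: "complex mat \<Rightarrow> complex mat \<Rightarrow> complex mat" where
  "replacer \<tau> X = mtrace X \<cdot>\<^sub>m \<tau>"

lemma replacer_cptp: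
  assumes \<tau>: "\<tau> \<in> density b"
  shows "replacer \<tau> \<in> cptp a b"
proof -
  note c = densityD[OF \<tau>]
  have lin: "linear_op a b (replacer \<tau>)"
    using c by (auto simp: linear_op_def replacer_def mtrace_def sum.distrib sum_distrib_left
        distrib_right mult.assoc intro!: eq_matI)
  have "completely_positive a b (replacer \<tau>)"
    unfolding completely_positive_def
  proof (intro allI impI)
    fix r X assume X: "psd (r * a) X"
    \<comment> \<open>The partial trace of \<open>X\<close> over the system. The amplified replacer
      sends \<open>X\<close> to \<open>kron P \<tau>\<close>, so it suffices that \<open>P\<close>
      is positive.\<close>
    define P where "P = mat r r (\<lambda>(i, j). \<Sum>k<a. X $$ (i * a + k, j * a + k))"
    have "pos_form r (\<lambda>i j. P $$ (i, j))"
      unfolding pos_form_def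
    proof
      fix x
      \<comment> \<open>For fixed \<open>k\<close> this is a principal submatrix of
        \<open>X\<close>; \<open>P\<close> is the sum of these.\<close>
      have pf: "pos_form r (\<lambda>i j. X $$ (i * a + k, j * a + k))" if "k < a" for k
        using psd_reindex[OF X, of r "\<lambda>i. i * a + k"] that
        by (simp add: psd_iff_pos_form pair_index_less reindex_index pos_form_def)
      have "(\<Sum>i<r. \<Sum>j<r. P $$ (i, j) * x j * cnj (x i))
          = (\<Sum>i<r. \<Sum>j<r. \<Sum>k<a. X $$ (i * a + k, j * a + k) * x j * cnj (x i))"
        by (simp add: P_def sum_distrib_right)
      also have "\<dots> = (\<Sum>k<a. \<Sum>i<r. \<Sum>j<r. X $$ (i * a + k, j * a + k) * x j * cnj (x i))"
        by (simp only: sum.swap[where B = "{..<a}"])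
      also have "0 \<le> \<dots>" by (intro sum_nonneg pos_formD[OF pf]) simp
      finally show "0 \<le> (\<Sum>i<r. \<Sum>j<r. P $$ (i, j) * x j * cnj (x i))" .
    qed
    then have P: "P \<in> carrier_mat r r" "psd r P"
      by (simp_all add: P_def psd_iff_pos_form)
    have "ampl r a b (replacer \<tau>) X = kron P \<tau>"
    proof (rule eq_mat_pairI[OF tensor_op_carrier kron_carrier[OF P(1) c]])
      fix i j s t assume *: "i < r" "j < r" "s < b" "t < b"
      have "ampl r a b (replacer \<tau>) X $$ (i * b + s, j * b + t) = P $$ (i, j) * \<tau> $$ (s, t)"
        using * c by (simp add: ampl_index[OF lin] replacer_def mtrace_mat_unit P_def
            if_distrib[of "\<lambda>x. _ * x"] if_distrib[of "\<lambda>x. x * _"] sum_distrib_right cong: if_cong)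
      then show "ampl r a b (replacer \<tau>) X $$ (i * b + s, j * b + t)
          = kron P \<tau> $$ (i * b + s, j * b + t)"
        by (simp add: kron_index[OF P(1) c *])
    qed
    then show "psd (r * b) (ampl r a b (replacer \<tau>) X)"
      using psd_kron[OF P(2)] \<tau> by (simp add: density_def)
  qed
  moreover have "mtrace (replacer \<tau> X) = mtrace X" for X
  proof -
    have "mtrace (replacer \<tau> X) = mtrace X * mtrace \<tau>"
      using c by (auto simp: replacer_def mtrace_def[of \<tau>] mtrace_def[of "_ \<cdot>\<^sub>m _"] sum_distrib_left)
    then show ?thesis using \<tau> by (simp add: density_def)
  qed
  ultimately show ?thesis using lin by (simp add: cptp_def)
qed

section \<open>Exchanging tensor factors\<close>

text \<open>Decodes a four-digit index whose last three radices are \<open>a\<close>,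
  \<open>b\<close>, \<open>c\<close> and exchanges the two middle digits. Since
  \<open>reindex\<close> pulls back, \<open>reindex n (swap_mid a b c)\<close> takes a matrix with
  factor order \<open>r\<close>, \<open>b\<close>, \<open>a\<close>, \<open>c\<close> to the order
  \<open>r\<close>, \<open>a\<close>, \<open>b\<close>, \<open>c\<close>.\<close>

definition swap_mid :: "nat \<Rightarrow> nat \<Rightarrow> nat \<Rightarrow> nat \<Rightarrow> nat" where
  "swap_mid a b c p =
     ((p div c div b div a * b + p div c mod b) * a + p div c div b mod a) * c + p mod c"

lemma swap_mid_index:
  "j < a \<Longrightarrow> k < b \<Longrightarrow> l < c \<Longrightarrow>
    swap_mid a b c (((i * a + j) * b + k) * c + l) = ((i * b + k) * a + j) * c + l"
  by (simp add: swap_mid_def)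

lemma quad_index_cases:
  fixes p :: nat
  assumes "p < r * a * b * c"
  obtains i j k l where "i < r" "j < a" "k < b" "l < c" "p = ((i * a + j) * b + k) * c + l"
  using assms by (elim pair_index_cases) blast

lemma bij_swap_mid:
  assumes "n = r * a * b * c"
  shows "bij_betw (swap_mid a b c) {..<n} {..<n}"
proof (rule bij_betw_byWitness[where f' = "swap_mid b a c"])
  have n': "n = r * b * a * c" using assms by simp
  have 1: "swap_mid b a c (swap_mid a b c p) = p \<and> swap_mid a b c p < n" if "p < n" for p
    using that[unfolded assms]
    by (elim quad_index_cases) (simp add: swap_mid_index n' pair_index_less)
  have 2: "swap_mid a b c (swap_mid b a c p) = p \<and> swap_mid b a c p < n" if "p < n" for p
    using that[unfolded n']
    by (elim quad_index_cases) (simp add: swap_mid_index assms pair_index_less)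
  show "\<forall>p\<in>{..<n}. swap_mid b a c (swap_mid a b c p) = p"
    "\<forall>p\<in>{..<n}. swap_mid a b c (swap_mid b a c p) = p"
    "swap_mid a b c ` {..<n} \<subseteq> {..<n}" "swap_mid b a c ` {..<n} \<subseteq> {..<n}"
    using 1 2 by auto
qed

text \<open>This lets a tensor product of maps be evaluated on matrix units of the composite space
  through its values on product matrices.\<close>

lemma mat_unit_pair:
  assumes "i < m" "j < m" "k < n" "l < n"
  shows "mat_unit (m * n) (i * n + k) (j * n + l) = kron (mat_unit m i j) (mat_unit n k l)"
proof (rule eq_mat_pairI[OF mat_unit_carrier kron_carrier[OF mat_unit_carrier mat_unit_carrier]])
  have inj: "p * n + q = i * n + k \<longleftrightarrow> p = i \<and> q = k" if "q < n" "k < n" for p q i k :: nat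
    using that by (metis add.commute div_mult_self1 div_less mod_less mod_mult_self1 add_0 less_nat_zero_code)
  fix p p' q q' assume "p < m" "p' < m" "q < n" "q' < n"
  note lt = this
  have "kron (mat_unit m i j) (mat_unit n k l) $$ (p * n + q, p' * n + q')
      = mat_unit m i j $$ (p, p') * mat_unit n k l $$ (q, q')"
    using lt by (intro kron_index[OF mat_unit_carrier mat_unit_carrier])
  then show "mat_unit (m * n) (i * n + k) (j * n + l) $$ (p * n + q, p' * n + q')
      = kron (mat_unit m i j) (mat_unit n k l) $$ (p * n + q, p' * n + q')"
    using assms lt by (simp add: mat_unit_def pair_index_less inj)
qed

lemma tensor_op_mat_unit_index:
  assumes N: "linear_op a1 b1 N" and M: "linear_op a2 b2 M"
    and "i < a1" "j < a1" "k < a2" "l < a2" "s1 < b1" "t1 < b1" "s2 < b2" "t2 < b2"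
  shows "tensor_op a1 b1 N a2 b2 M (mat_unit (a1 * a2) (i * a2 + k) (j * a2 + l))
      $$ (s1 * b2 + s2, t1 * b2 + t2)
    = N (mat_unit a1 i j) $$ (s1, t1) * M (mat_unit a2 k l) $$ (s2, t2)"
  using assms kron_index[OF linear_op_carrier[OF N mat_unit_carrier]
      linear_op_carrier[OF M mat_unit_carrier] assms(7-)]
  by (simp add: mat_unit_pair tensor_op_kron[OF N M] mat_unit_carrier)

lemma ampl_tensor_op_index:
  assumes N: "linear_op a1 b1 N" and M: "linear_op a2 b2 M"
    and "i < r" "j < r" "s1 < b1" "t1 < b1" "s2 < b2" "t2 < b2"
  shows "ampl r (a1 * a2) (b1 * b2) (tensor_op a1 b1 N a2 b2 M) X
      $$ ((i * b1 + s1) * b2 + s2, (j * b1 + t1) * b2 + t2)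
    = (\<Sum>k1<a1. \<Sum>l1<a1. \<Sum>k2<a2. \<Sum>l2<a2.
        X $$ ((i * a1 + k1) * a2 + k2, (j * a1 + l1) * a2 + l2) *
        (N (mat_unit a1 k1 l1) $$ (s1, t1) * M (mat_unit a2 k2 l2) $$ (s2, t2)))"
proof -
  \<comment> \<open>Associativity of the encoding: one three-digit index addresses both (R A1) A2
    and R (A1 A2).\<close>
  have idx: "(i * m + k) * n + l = i * (m * n) + (k * n + l)" for i m n k l :: nat
    by (simp add: algebra_simps)
  have "ampl r (a1 * a2) (b1 * b2) (tensor_op a1 b1 N a2 b2 M) X
      $$ ((i * b1 + s1) * b2 + s2, (j * b1 + t1) * b2 + t2)
    = (\<Sum>k<a1 * a2. \<Sum>l<a1 * a2. X $$ (i * (a1 * a2) + k, j * (a1 * a2) + l) *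
        tensor_op a1 b1 N a2 b2 M (mat_unit (a1 * a2) k l) $$ (s1 * b2 + s2, t1 * b2 + t2))"
    unfolding idx using assms by (intro ampl_index linear_op_tensor_op pair_index_less)
  also have "\<dots> = (\<Sum>k1<a1. \<Sum>k2<a2. \<Sum>l1<a1. \<Sum>l2<a2.
        X $$ ((i * a1 + k1) * a2 + k2, (j * a1 + l1) * a2 + l2) *
        (N (mat_unit a1 k1 l1) $$ (s1, t1) * M (mat_unit a2 k2 l2) $$ (s2, t2)))"
    unfolding sum_pair_index idx
    using assms by (intro sum.cong refl) (simp add: tensor_op_mat_unit_index[OF N M])
  also have "\<dots> = (\<Sum>k1<a1. \<Sum>l1<a1. \<Sum>k2<a2. \<Sum>l2<a2.
        X $$ ((i * a1 + k1) * a2 + k2, (j * a1 + l1) * a2 + l2) *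
        (N (mat_unit a1 k1 l1) $$ (s1, t1) * M (mat_unit a2 k2 l2) $$ (s2, t2)))"
    by (intro sum.cong refl sum.swap)
  finally show ?thesis .
qed

lemma eq_mat_tripleI:
  assumes "A \<in> carrier_mat (r * (m * n)) (r * (m * n))" "B \<in> carrier_mat (r * (m * n)) (r * (m * n))"
    and "\<And>i j s1 t1 s2 t2. i < r \<Longrightarrow> j < r \<Longrightarrow> s1 < m \<Longrightarrow> t1 < m \<Longrightarrow> s2 < n \<Longrightarrow> t2 < n \<Longrightarrow>
      A $$ ((i * m + s1) * n + s2, (j * m + t1) * n + t2)
      = B $$ ((i * m + s1) * n + s2, (j * m + t1) * n + t2)"
  shows "A = B"
proof (rule eq_mat_pairI)
  show "A \<in> carrier_mat (r * m * n) (r * m * n)" "B \<in> carrier_mat (r * m * n) (r * m * n)"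
    using assms(1,2) by (simp_all add: mult.assoc)
  fix p q s t assume "p < r * m" "q < r * m" "s < n" "t < n"
  then show "A $$ (p * n + s, q * n + t) = B $$ (p * n + s, q * n + t)"
    by (elim pair_index_cases) (simp add: assms(3))
qed

text \<open>
  Since \<^term>\<open>ampl\<close> has the reference system on the left, \<open>N\<close> acts only after its
  system has been exchanged with the output of \<open>M\<close>.
\<close>

lemma ampl_tensor_op:
  assumes N: "linear_op a1 b1 N" and M: "linear_op a2 b2 M"
  shows "ampl r (a1 * a2) (b1 * b2) (tensor_op a1 b1 N a2 b2 M) X =
    reindex (r * (b1 * b2)) (swap_mid b1 b2 1) (ampl (r * b2) a1 b1 N
      (reindex (r * b2 * a1) (swap_mid b2 a1 1) (ampl (r * a1) a2 b2 M X)))"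
    (is "_ = ?R")
proof (rule eq_mat_tripleI[OF tensor_op_carrier reindex_carrier])
  fix i j s1 t1 s2 t2
  assume lt: "i < r" "j < r" "s1 < b1" "t1 < b1" "s2 < b2" "t2 < b2"
  \<comment> \<open>With a trailing factor of dimension 1, whose digit is 0, the last two of three
    factors are exchanged. \<open>Suc 0\<close> is the form to which the simplifier brings
    1.\<close>
  have sw: "swap_mid a b (Suc 0) ((i * a + j) * b + k) = (i * b + k) * a + j"
    if "j < a" "k < b" for a b i j k
    using swap_mid_index[of j a k b 0 1 i] that by simp
  have b: "(i * b1 + s1) * b2 + s2 < r * (b1 * b2)" if "i < r" "s1 < b1" "s2 < b2" for i s1 s2
    using that by (simp add: pair_index_less mult.assoc[symmetric])
  show "ampl r (a1 * a2) (b1 * b2) (tensor_op a1 b1 N a2 b2 M) X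
      $$ ((i * b1 + s1) * b2 + s2, (j * b1 + t1) * b2 + t2)
    = ?R $$ ((i * b1 + s1) * b2 + s2, (j * b1 + t1) * b2 + t2)"
    using lt unfolding ampl_tensor_op_index[OF N M lt]
    by (simp add: reindex_index b sw ampl_index[OF N] ampl_index[OF M] pair_index_less
        sum_distrib_right) (simp add: mult_ac)
qed

text \<open>Moving R2 past the first system commutes with the channels: the order R1 A1 R2 A2
  becomes R1 R2 A1 A2 before they act, and R1 B1 R2 B2 becomes R1 R2 B1 B2 after. Entrywise, the sum
  over both systems factorizes.\<close>

lemma ampl_tensor_op_kron:
  assumes N: "linear_op a1 b1 N" and M: "linear_op a2 b2 M"
    and X: "X \<in> carrier_mat (r1 * a1) (r1 * a1)" and Y: "Y \<in> carrier_mat (r2 * a2) (r2 * a2)"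
  shows "ampl (r1 * r2) (a1 * a2) (b1 * b2) (tensor_op a1 b1 N a2 b2 M)
      (reindex (r1 * r2 * (a1 * a2)) (swap_mid r2 a1 a2) (kron X Y))
    = reindex (r1 * r2 * (b1 * b2)) (swap_mid r2 b1 b2) (kron (ampl r1 a1 b1 N X) (ampl r2 a2 b2 M Y))"
    (is "?L = ?R")
proof (rule eq_mat_tripleI[OF tensor_op_carrier reindex_carrier])
  fix i j s1 t1 s2 t2
  assume lt: "i < r1 * r2" "j < r1 * r2" "s1 < b1" "t1 < b1" "s2 < b2" "t2 < b2"
  obtain i1 i2 where i: "i1 < r1" "i2 < r2" "i = i1 * r2 + i2" using lt(1) by (rule pair_index_cases)
  obtain j1 j2 where j: "j1 < r1" "j2 < r2" "j = j1 * r2 + j2" using lt(2) by (rule pair_index_cases)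
  have lt3: "(i * m + s) * n + t < r * (m * n)" if "i < r" "s < m" "t < n" for i s t r m n :: nat
    using that by (simp add: pair_index_less mult.assoc[symmetric])
  \<comment> \<open>The exchanged index is regrouped as a pair of two-digit indices, the form in
    which \<open>kron_index\<close> applies.\<close>
  have sw: "swap_mid a b c (((i * a + j) * b + k) * c + l) = (i * b + k) * (a * c) + (j * c + l)"
    if "j < a" "k < b" "l < c" for a b c i j k l
    unfolding swap_mid_index[OF that] by (simp add: algebra_simps)
  have "?L $$ ((i * b1 + s1) * b2 + s2, (j * b1 + t1) * b2 + t2)
    = (\<Sum>k1<a1. \<Sum>l1<a1. \<Sum>k2<a2. \<Sum>l2<a2.
        (X $$ (i1 * a1 + k1, j1 * a1 + l1) * N (mat_unit a1 k1 l1) $$ (s1, t1)) *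
        (Y $$ (i2 * a2 + k2, j2 * a2 + l2) * M (mat_unit a2 k2 l2) $$ (s2, t2)))"
    unfolding ampl_tensor_op_index[OF N M lt]
  proof (intro sum.cong refl)
    fix k1 l1 k2 l2 assume k: "k1 \<in> {..<a1}" "l1 \<in> {..<a1}" "k2 \<in> {..<a2}" "l2 \<in> {..<a2}"
    have "reindex (r1 * r2 * (a1 * a2)) (swap_mid r2 a1 a2) (kron X Y)
        $$ ((i * a1 + k1) * a2 + k2, (j * a1 + l1) * a2 + l2)
      = X $$ (i1 * a1 + k1, j1 * a1 + l1) * Y $$ (i2 * a2 + k2, j2 * a2 + l2)"
      using k lt i(1,2) j(1,2) kron_index[OF X Y]
      by (simp add: reindex_index lt3 pair_index_less) (simp add: i j sw pair_index_less)
    then show "reindex (r1 * r2 * (a1 * a2)) (swap_mid r2 a1 a2) (kron X Y)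
        $$ ((i * a1 + k1) * a2 + k2, (j * a1 + l1) * a2 + l2) *
        (N (mat_unit a1 k1 l1) $$ (s1, t1) * M (mat_unit a2 k2 l2) $$ (s2, t2))
      = (X $$ (i1 * a1 + k1, j1 * a1 + l1) * N (mat_unit a1 k1 l1) $$ (s1, t1)) *
        (Y $$ (i2 * a2 + k2, j2 * a2 + l2) * M (mat_unit a2 k2 l2) $$ (s2, t2))"
      by (simp add: mult_ac)
  qed
  also have "\<dots> = ampl r1 a1 b1 N X $$ (i1 * b1 + s1, j1 * b1 + t1)
      * ampl r2 a2 b2 M Y $$ (i2 * b2 + s2, j2 * b2 + t2)"
    using i j lt by (simp only: ampl_index[OF N] ampl_index[OF M] sum_distrib_right)
      (simp only: sum_distrib_left)
  also have "\<dots> = ?R $$ ((i * b1 + s1) * b2 + s2, (j * b1 + t1) * b2 + t2)"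
    using lt i(1,2) j(1,2) kron_index[OF tensor_op_carrier[of r1 b1 "\<lambda>Y. Y" r1 a1 N X] tensor_op_carrier]
    by (simp add: reindex_index lt3 pair_index_less) (simp add: i j sw pair_index_less kron_index[OF tensor_op_carrier tensor_op_carrier])
  finally show "?L $$ ((i * b1 + s1) * b2 + s2, (j * b1 + t1) * b2 + t2)
    = ?R $$ ((i * b1 + s1) * b2 + s2, (j * b1 + t1) * b2 + t2)" .
qed

section \<open>Divergences\<close>

lemma divergence_mono:
  assumes "state_divergence D" "\<rho> \<in> density a" "\<sigma> \<in> density a" "E \<in> cptp a b"
  shows "D (E \<rho>) (E \<sigma>) \<le> D \<rho> \<sigma>"
  using assms unfolding state_divergence_def by blast

lemma divergence_reindex:
  assumes D: "state_divergence D" and \<rho>: "\<rho> \<in> density n" and \<sigma>: "\<sigma> \<in> density n"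
    and f: "bij_betw f {..<n} {..<n}"
  shows "D (reindex n f \<rho>) (reindex n f \<sigma>) = D \<rho> \<sigma>"
proof (rule antisym)
  show "D (reindex n f \<rho>) (reindex n f \<sigma>) \<le> D \<rho> \<sigma>"
    by (rule divergence_mono[OF D \<rho> \<sigma> reindex_cptp[OF f]])
  define g where "g = inv_into {..<n} f"
  have g: "bij_betw g {..<n} {..<n}" unfolding g_def by (rule bij_betw_inv_into[OF f])
  have fg: "f (g p) = p" "g p < n" if "p < n" for p
    using that bij_betw_inv_into_right[OF f, of p] bij_betwE[OF g] by (auto simp: g_def)
  have inv: "reindex n g (reindex n f X) = X" if "X \<in> carrier_mat n n" for X
    using that fg by (intro eq_matI) (auto simp: reindex_def)
  show "D \<rho> \<sigma> \<le> D (reindex n f \<rho>) (reindex n f \<sigma>)"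
    using divergence_mono[OF D reindex_density[OF \<rho> f] reindex_density[OF \<sigma> f] reindex_cptp[OF g]]
    by (simp add: inv densityD[OF \<rho>] densityD[OF \<sigma>])
qed

lemma divergence_self_le:
  assumes "state_divergence D" "\<rho> \<in> density a" "\<sigma> \<in> density a" "\<tau> \<in> density b"
  shows "D \<tau> \<tau> \<le> D \<rho> \<sigma>"
proof -
  have "replacer \<tau> X = \<tau>" if "X \<in> density a" for X
    using that by (auto simp: replacer_def density_def)
  with divergence_mono[OF assms(1-3) replacer_cptp[OF assms(4)]] assms(2,3) show ?thesis by simp
qed

text \<open>Replacement channels lead from \<tau> to \<tau> \<otimes> \<tau> and back, so both have
  the same self-divergence. By additivity this value equals its own double, and the given pair of
  finite divergence excludes \<infinity>.\<close>

lemma divergence_self: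
  assumes D: "state_divergence D" and add: "tensor_additive D"
    and fin: "\<rho> \<in> density a" "\<sigma> \<in> density a" "D \<rho> \<sigma> < \<infinity>" and \<tau>: "\<tau> \<in> density b"
  shows "D \<tau> \<tau> = 0"
proof -
  have k: "kron \<tau> \<tau> \<in> density (b * b)" by (rule kron_density[OF \<tau> \<tau>])
  have "D (kron \<tau> \<tau>) (kron \<tau> \<tau>) = D \<tau> \<tau>"
    by (intro antisym divergence_self_le[OF D \<tau> \<tau> k] divergence_self_le[OF D k k \<tau>])
  moreover have "D (kron \<tau> \<tau>) (kron \<tau> \<tau>) = D \<tau> \<tau> + D \<tau> \<tau>"
    using add \<tau> unfolding tensor_additive_def by blast
  moreover have "D \<tau> \<tau> < \<infinity>"
    using divergence_self_le[OF D fin(1,2) \<tau>] fin(3) by (rule le_less_trans)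
  moreover have "D \<tau> \<tau> \<noteq> - \<infinity>"
    using D \<tau> unfolding state_divergence_def by blast
  ultimately show ?thesis by (cases "D \<tau> \<tau>") auto
qed

lemma divergence_nonneg:
  assumes "state_divergence D" "tensor_additive D"
    and "\<rho> \<in> density a" "\<sigma> \<in> density a" "D \<rho> \<sigma> < \<infinity>" "\<rho>' \<in> density b" "\<sigma>' \<in> density b"
  shows "0 \<le> D \<rho>' \<sigma>'"
  using divergence_self[OF assms(1-5), of \<rho>' b] divergence_self_le[OF assms(1,6,7), of \<rho>' b] assms(6)
  by simp

section \<open>Bounds on the amortized divergence\<close>

lemma amortized_upper:
  assumes "\<rho> \<in> density (r * a)" "\<sigma> \<in> density (r * a)" "D \<rho> \<sigma> < \<infinity>"
  shows "D (ampl r a b N \<rho>) (ampl r a b M \<sigma>) - D \<rho> \<sigma> \<le> amortized_divergence D a b N M"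
  unfolding amortized_divergence_def using assms by (intro Sup_upper) blast

lemma amortized_upper':
  assumes "state_divergence D" "\<rho> \<in> density (r * a)" "\<sigma> \<in> density (r * a)" "D \<rho> \<sigma> < \<infinity>"
  shows "D (ampl r a b N \<rho>) (ampl r a b M \<sigma>) \<le> amortized_divergence D a b N M + D \<rho> \<sigma>"
proof -
  have "D \<rho> \<sigma> \<noteq> - \<infinity>" using assms unfolding state_divergence_def by blast
  then show ?thesis
    using amortized_upper[of \<rho> r a \<sigma> D b N M] assms
    by (cases "D \<rho> \<sigma>") (auto simp: ereal_minus_le)
qed

text \<open>A trivial reference system and two equal input states give subtrahend 0 and a
  nonnegative output divergence.\<close>

lemma amortized_nonneg:
  assumes D: "state_divergence D" "tensor_additive D"
    and fin: "\<rho> \<in> density n" "\<sigma> \<in> density n" "D \<rho> \<sigma> < \<infinity>"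
    and "0 < a" "N \<in> cptp a b" "M \<in> cptp a b"
  shows "0 \<le> amortized_divergence D a b N M"
proof -
  define \<tau> where "\<tau> = mat_unit (1 * a) 0 0"
  have \<tau>: "\<tau> \<in> density (1 * a)" using mat_unit_density[of "1 * a"] assms by (simp add: \<tau>_def)
  have 0: "D \<tau> \<tau> = 0" by (rule divergence_self[OF D fin \<tau>])
  have "0 \<le> D (ampl 1 a b N \<tau>) (ampl 1 a b M \<tau>)"
    using ampl_density[OF assms(7) \<tau>] ampl_density[OF assms(8) \<tau>] by (rule divergence_nonneg[OF D fin])
  also have "\<dots> \<le> amortized_divergence D a b N M"
    using amortized_upper[of \<tau> 1 a \<tau> D b N M] \<tau> 0 by simp
  finally show ?thesis .
qed

text \<open>The suprema are taken one after the other, a translation by a constant commuting with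
  each. Excluding -\<infinity> matters: with \<infinity> + -\<infinity> = \<infinity>, adding
  -\<infinity> need not commute with a supremum.\<close>

lemma ereal_Sup_add_le:
  fixes S T :: "ereal set"
  assumes "\<And>x y. x \<in> S \<Longrightarrow> y \<in> T \<Longrightarrow> x + y \<le> c" "S \<noteq> {}" "T \<noteq> {}"
    and "\<And>y. y \<in> T \<Longrightarrow> y \<noteq> - \<infinity>" "Sup S \<noteq> - \<infinity>"
  shows "Sup S + Sup T \<le> c"
proof -
  have "Sup S + y \<le> c" if "y \<in> T" for y
  proof -
    have "Sup S + y = (SUP x\<in>S. x + y)"
      using SUP_ereal_add_left[OF assms(2) assms(4)[OF that], of "\<lambda>x. x"] by simp
    also have "\<dots> \<le> c" using assms(1)[OF _ that] by (rule SUP_least)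
    finally show ?thesis .
  qed
  then have "(SUP y\<in>T. Sup S + y) \<le> c" by (rule SUP_least)
  then show ?thesis using SUP_ereal_add_right[OF assms(3,5), of "\<lambda>x. x"] by simp
qed

theorem lemma13:
  fixes D :: "complex mat \<Rightarrow> complex mat \<Rightarrow> ereal"
    and a1 b1 a2 b2 :: nat
    and N1 M1 N2 M2 :: "complex mat \<Rightarrow> complex mat"
  assumes "state_divergence D"
    and "tensor_additive D"
    and "a1 > 0" and "a2 > 0"
    and "N1 \<in> cptp a1 b1" and "M1 \<in> cptp a1 b1"
    and "N2 \<in> cptp a2 b2" and "M2 \<in> cptp a2 b2"
  shows "amortized_divergence D (a1 * a2) (b1 * b2)
           (tensor_op a1 b1 N1 a2 b2 N2) (tensor_op a1 b1 M1 a2 b2 M2)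
         = amortized_divergence D a1 b1 N1 M1 + amortized_divergence D a2 b2 N2 M2"
proof (cases "\<exists>n. \<exists>\<rho>\<in>density n. \<exists>\<sigma>\<in>density n. D \<rho> \<sigma> < \<infinity>")
  case False
  \<comment> \<open>Each supremum ranges over the empty set.\<close>
  then have "amortized_divergence D a b N M = - \<infinity>" for a b N M
    unfolding amortized_divergence_def by (subst Sup_eq_MInfty) blast
  then show ?thesis by simp
next
  case True
  then obtain n \<rho>\<^sub>0 \<sigma>\<^sub>0 where fin: "\<rho>\<^sub>0 \<in> density n" "\<sigma>\<^sub>0 \<in> density n" "D \<rho>\<^sub>0 \<sigma>\<^sub>0 < \<infinity>" by blast
  note D = assms(1,2)
  note lin = assms(5-8)[THEN cptpD(1)]
  note nonneg = divergence_nonneg[OF D fin]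
  let ?A = "amortized_divergence D (a1 * a2) (b1 * b2)
           (tensor_op a1 b1 N1 a2 b2 N2) (tensor_op a1 b1 M1 a2 b2 M2)"
  let ?A1 = "amortized_divergence D a1 b1 N1 M1"
  let ?A2 = "amortized_divergence D a2 b2 N2 M2"
  have A1: "0 \<le> ?A1" and A2: "0 \<le> ?A2"
    using assms by (auto intro!: amortized_nonneg[OF D fin])
  show ?thesis
  proof (rule antisym)
    show "?A \<le> ?A1 + ?A2"
      unfolding amortized_divergence_def[of D "a1 * a2"]
    proof (rule Sup_least, clarify)
      fix r \<rho> \<sigma>
      assume "\<rho> \<in> density (r * (a1 * a2))" "\<sigma> \<in> density (r * (a1 * a2))" and less: "D \<rho> \<sigma> < \<infinity>"
      then have \<rho>: "\<rho> \<in> density (r * a1 * a2)" and \<sigma>: "\<sigma> \<in> density (r * a1 * a2)"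
        by (simp_all add: mult.assoc)
      let ?f = "swap_mid b2 a1 1" and ?g = "swap_mid b1 b2 1"
      \<comment> \<open>The three stages live on R A1 B2, on R B2 A1 and on R B2 B1.\<close>
      define \<rho>1 \<sigma>1 where "\<rho>1 = ampl (r * a1) a2 b2 N2 \<rho>" and "\<sigma>1 = ampl (r * a1) a2 b2 M2 \<sigma>"
      define \<rho>2 \<sigma>2 where "\<rho>2 = reindex (r * b2 * a1) ?f \<rho>1" and "\<sigma>2 = reindex (r * b2 * a1) ?f \<sigma>1"
      define \<rho>3 \<sigma>3 where "\<rho>3 = ampl (r * b2) a1 b1 N1 \<rho>2" and "\<sigma>3 = ampl (r * b2) a1 b1 M1 \<sigma>2"
      have dim1: "r * a1 * b2 = r * b2 * a1" by simp
      have d1: "\<rho>1 \<in> density (r * b2 * a1)" "\<sigma>1 \<in> density (r * b2 * a1)"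
        using ampl_density[OF assms(7) \<rho>] ampl_density[OF assms(8) \<sigma>]
        unfolding \<rho>1_def \<sigma>1_def dim1 .
      have bf: "bij_betw ?f {..<r * b2 * a1} {..<r * b2 * a1}"
        by (rule bij_swap_mid[of _ r]) simp
      have d2: "\<rho>2 \<in> density (r * b2 * a1)" "\<sigma>2 \<in> density (r * b2 * a1)"
        using d1 bf by (simp_all add: \<rho>2_def \<sigma>2_def reindex_density)
      have dim3: "r * b2 * b1 = r * (b1 * b2)" by simp
      have d3: "\<rho>3 \<in> density (r * (b1 * b2))" "\<sigma>3 \<in> density (r * (b1 * b2))"
        using ampl_density[OF assms(5) d2(1)] ampl_density[OF assms(6) d2(2)]
        unfolding \<rho>3_def \<sigma>3_def dim3 .
      have bg: "bij_betw ?g {..<r * (b1 * b2)} {..<r * (b1 * b2)}"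
        by (rule bij_swap_mid[of _ r]) simp
      let ?out = "D (ampl r (a1 * a2) (b1 * b2) (tensor_op a1 b1 N1 a2 b2 N2) \<rho>)
          (ampl r (a1 * a2) (b1 * b2) (tensor_op a1 b1 M1 a2 b2 M2) \<sigma>)"
      have out: "?out = D \<rho>3 \<sigma>3"
        using lin divergence_reindex[OF D(1) d3 bg]
        by (simp add: ampl_tensor_op \<rho>1_def \<sigma>1_def \<rho>2_def \<sigma>2_def \<rho>3_def \<sigma>3_def)
      have 21: "D \<rho>2 \<sigma>2 = D \<rho>1 \<sigma>1"
        unfolding \<rho>2_def \<sigma>2_def by (rule divergence_reindex[OF D(1) d1 bf])
      have 1: "D \<rho>1 \<sigma>1 \<le> ?A2 + D \<rho> \<sigma>"
        unfolding \<rho>1_def \<sigma>1_def by (rule amortized_upper'[OF D(1) \<rho> \<sigma> less])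
      \<comment> \<open>The intermediate pair competes in the supremum \<open>?A1\<close> only if
        its divergence is finite. Otherwise \<open>?A2\<close> is already \<infinity>, because
        \<open>D \<rho> \<sigma>\<close> is finite, and the bound is trivial.\<close>
      have "D \<rho>3 \<sigma>3 \<le> (?A1 + ?A2) + D \<rho> \<sigma>"
      proof (cases "D \<rho>2 \<sigma>2 < \<infinity>")
        case True
        then have "D \<rho>3 \<sigma>3 \<le> ?A1 + D \<rho>2 \<sigma>2"
          unfolding \<rho>3_def \<sigma>3_def by (rule amortized_upper'[OF D(1) d2])
        also have "\<dots> \<le> ?A1 + (?A2 + D \<rho> \<sigma>)" by (intro add_left_mono) (simp add: 21 1)
        finally show ?thesis by (simp add: add.assoc)
      next
        case False
        then have "?A2 + D \<rho> \<sigma> = \<infinity>" using 1 21 by simp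
        then have "?A2 = \<infinity>" using less by auto
        then show ?thesis using A1 nonneg[OF \<rho> \<sigma>] by simp
      qed
      then show "?out - D \<rho> \<sigma> \<le> ?A1 + ?A2"
        using less nonneg[OF \<rho> \<sigma>] unfolding out
        by (cases "D \<rho> \<sigma>") (auto simp: ereal_minus_le)
    qed
  next
    let ?S = "\<lambda>a b N M. {D (ampl r a b N \<rho>) (ampl r a b M \<sigma>) - D \<rho> \<sigma> | r \<rho> \<sigma>.
            \<rho> \<in> density (r * a) \<and> \<sigma> \<in> density (r * a) \<and> D \<rho> \<sigma> < \<infinity>}"
    have ne: "?S a b N M \<noteq> {}" if "0 < a" for a b N M
    proof -
      \<comment> \<open>A state paired with itself, with reference dimension 1, has divergence 0 and
        is therefore admissible.\<close>
      have \<tau>: "mat_unit a 0 0 \<in> density (1 * a)" using that by (simp add: mat_unit_density)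
      then have "D (mat_unit a 0 0) (mat_unit a 0 0) < \<infinity>" using divergence_self[OF D fin] by simp
      with \<tau> show ?thesis by blast
    qed
    have "Sup (?S a1 b1 N1 M1) + Sup (?S a2 b2 N2 M2) \<le> ?A"
    proof (rule ereal_Sup_add_le)
      show "?S a1 b1 N1 M1 \<noteq> {}" "?S a2 b2 N2 M2 \<noteq> {}" using ne assms(3,4) by auto
      show "Sup (?S a1 b1 N1 M1) \<noteq> - \<infinity>" using A1 by (auto simp: amortized_divergence_def)
    next
      fix y assume "y \<in> ?S a2 b2 N2 M2"
      then obtain r \<rho> \<sigma> where y: "y = D (ampl r a2 b2 N2 \<rho>) (ampl r a2 b2 M2 \<sigma>) - D \<rho> \<sigma>"
        and *: "\<rho> \<in> density (r * a2)" "\<sigma> \<in> density (r * a2)" "D \<rho> \<sigma> < \<infinity>" by blast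
      have "0 \<le> D (ampl r a2 b2 N2 \<rho>) (ampl r a2 b2 M2 \<sigma>)"
        using ampl_density[OF assms(7) *(1)] ampl_density[OF assms(8) *(2)] by (rule nonneg)
      then show "y \<noteq> - \<infinity>" using *(3) unfolding y
        by (cases "D \<rho> \<sigma>"; cases "D (ampl r a2 b2 N2 \<rho>) (ampl r a2 b2 M2 \<sigma>)") auto
    next
      fix x y assume "x \<in> ?S a1 b1 N1 M1" "y \<in> ?S a2 b2 N2 M2"
      then obtain r1 \<rho>1 \<sigma>1 r2 \<rho>2 \<sigma>2 where
        x: "x = D (ampl r1 a1 b1 N1 \<rho>1) (ampl r1 a1 b1 M1 \<sigma>1) - D \<rho>1 \<sigma>1"
        and 1: "\<rho>1 \<in> density (r1 * a1)" "\<sigma>1 \<in> density (r1 * a1)" and less1: "D \<rho>1 \<sigma>1 < \<infinity>"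
        and y: "y = D (ampl r2 a2 b2 N2 \<rho>2) (ampl r2 a2 b2 M2 \<sigma>2) - D \<rho>2 \<sigma>2"
        and 2: "\<rho>2 \<in> density (r2 * a2)" "\<sigma>2 \<in> density (r2 * a2)" and less2: "D \<rho>2 \<sigma>2 < \<infinity>"
        by blast
      let ?f = "swap_mid r2 a1 a2" and ?g = "swap_mid r2 b1 b2"
      let ?R = "r1 * r2 * (a1 * a2)" and ?R' = "r1 * r2 * (b1 * b2)"
      \<comment> \<open>The product inputs in the order R1 R2 A1 A2, so that R1 R2 serves as the
        reference system.\<close>
      define \<rho> \<sigma> where "\<rho> = reindex ?R ?f (kron \<rho>1 \<rho>2)" and "\<sigma> = reindex ?R ?f (kron \<sigma>1 \<sigma>2)"
      have bf: "bij_betw ?f {..<?R} {..<?R}" by (rule bij_swap_mid[of _ r1]) simp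
      have bg: "bij_betw ?g {..<?R'} {..<?R'}" by (rule bij_swap_mid[of _ r1]) simp
      have dim: "r1 * a1 * (r2 * a2) = ?R" by simp
      have k: "kron \<rho>1 \<rho>2 \<in> density ?R" "kron \<sigma>1 \<sigma>2 \<in> density ?R"
        using kron_density[OF 1(1) 2(1)] kron_density[OF 1(2) 2(2)] unfolding dim .
      have \<rho>\<sigma>: "\<rho> \<in> density ?R" "\<sigma> \<in> density ?R"
        using k bf by (simp_all add: \<rho>_def \<sigma>_def reindex_density)
      have in_eq: "D \<rho> \<sigma> = D \<rho>1 \<sigma>1 + D \<rho>2 \<sigma>2"
        using D(2) 1 2 divergence_reindex[OF D(1) k bf]
        unfolding \<rho>_def \<sigma>_def tensor_additive_def by simp
      note o1 = ampl_density[OF assms(5) 1(1)] ampl_density[OF assms(6) 1(2)]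
      note o2 = ampl_density[OF assms(7) 2(1)] ampl_density[OF assms(8) 2(2)]
      let ?o1 = "D (ampl r1 a1 b1 N1 \<rho>1) (ampl r1 a1 b1 M1 \<sigma>1)"
      let ?o2 = "D (ampl r2 a2 b2 N2 \<rho>2) (ampl r2 a2 b2 M2 \<sigma>2)"
      have dim': "r1 * b1 * (r2 * b2) = ?R'" by simp
      have k': "kron (ampl r1 a1 b1 N1 \<rho>1) (ampl r2 a2 b2 N2 \<rho>2) \<in> density ?R'"
        "kron (ampl r1 a1 b1 M1 \<sigma>1) (ampl r2 a2 b2 M2 \<sigma>2) \<in> density ?R'"
        using kron_density[OF o1(1) o2(1)] kron_density[OF o1(2) o2(2)] unfolding dim' .
      have "?o1 + ?o2 = D (kron (ampl r1 a1 b1 N1 \<rho>1) (ampl r2 a2 b2 N2 \<rho>2))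
          (kron (ampl r1 a1 b1 M1 \<sigma>1) (ampl r2 a2 b2 M2 \<sigma>2))"
        using D(2) o1 o2 unfolding tensor_additive_def by metis
      also have "\<dots> = D (ampl (r1 * r2) (a1 * a2) (b1 * b2) (tensor_op a1 b1 N1 a2 b2 N2) \<rho>)
          (ampl (r1 * r2) (a1 * a2) (b1 * b2) (tensor_op a1 b1 M1 a2 b2 M2) \<sigma>)"
        unfolding \<rho>_def \<sigma>_def ampl_tensor_op_kron[OF lin(1,3) 1(1)[THEN densityD] 2(1)[THEN densityD]]
          ampl_tensor_op_kron[OF lin(2,4) 1(2)[THEN densityD] 2(2)[THEN densityD]]
        by (rule divergence_reindex[OF D(1) k' bg, symmetric])
      finally have out_eq: "D (ampl (r1 * r2) (a1 * a2) (b1 * b2) (tensor_op a1 b1 N1 a2 b2 N2) \<rho>)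
          (ampl (r1 * r2) (a1 * a2) (b1 * b2) (tensor_op a1 b1 M1 a2 b2 M2) \<sigma>) = ?o1 + ?o2" by simp
      have nn: "0 \<le> D \<rho>1 \<sigma>1" "0 \<le> D \<rho>2 \<sigma>2" "0 \<le> ?o1" "0 \<le> ?o2"
        by (rule nonneg[OF 1] nonneg[OF 2] nonneg[OF o1] nonneg[OF o2])+
      \<comment> \<open>The subtrahends are finite and the outputs are not -\<infinity>, so the
        regrouping holds even when an output divergence is \<infinity>.\<close>
      have "x + y = (?o1 + ?o2) - (D \<rho>1 \<sigma>1 + D \<rho>2 \<sigma>2)"
        using nn less1 less2 unfolding x y
        by (cases "D \<rho>1 \<sigma>1"; cases "D \<rho>2 \<sigma>2"; cases ?o1; cases ?o2) auto
      also have "\<dots> \<le> ?A"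
        using amortized_upper[of \<rho> "r1 * r2" "a1 * a2" \<sigma> D "b1 * b2" "tensor_op a1 b1 N1 a2 b2 N2"
            "tensor_op a1 b1 M1 a2 b2 M2"] \<rho>\<sigma> less1 less2
        by (simp add: out_eq in_eq)
      finally show "x + y \<le> ?A" .
    qed
    then show "?A1 + ?A2 \<le> ?A"
      by (simp only: amortized_divergence_def[of D a1] amortized_divergence_def[of D a2])
  qed
qed

end
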